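(* Consider a general contribution game in which all reward functions $f_e$ are coordinate-convex and satisfy $f_e(s_e)=0$ whenever $s_u(e)=0$ for at least one $u\in e$. Then a setwise equilibrium always exists and can be computed efficiently (in polynomial time).
   Context: General contribution game: a finite hypergraph $G=(V,E)$, where each node $v\in V$ is a player with budget $B_v\ge0$ and each hyperedge $e\in E$, $e\subseteq V$, is a joint project of a set of players. A strategy of player $v$ assigns an effort $s_v(e)\ge 0$ to each hyperedge $e\ni v$ with $\sum_{e\ni v}s_v(e)\le B_v$; a state $s=(s_v)_{v\in V}$ consists of one strategy per player. Each hyperedge has a reward function $f_e:(\mathbb{R}_{\ge0})^{|e|}\to\mathbb{R}_{\ge0}$, nondecreasing in each argument and symmetric (and continuous and differentiable), evaluated at $s_e=(s_u(e))_{u\in e}$. The utility of $v$ is $w_v(s)=\sum_{e\ni v}f_e(s_e)$. A setwise equilibrium is a state $s$ such that for every $e\in E$, every nonempty $U\subseteq e$, and every joint deviation $s'_U=(s'_u)_{u\in U}$ there is at least one player $v\in U$ with $w_v(s)\ge w_v(s'_U,s_{-U})$. A function $f$ is coordinate-convex if $\partial^2 f/\partial x_i^2\ge0$ for each of its arguments $x_i$. *)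

theory Defs
  imports "HOL-Analysis.Analysis" "HOL-Computational_Algebra.Polynomial"
begin

section \<open>General contribution games\<close>

text \<open>
  The argument tuples of a reward function \<open>f\<^sub>e : (\<real>\<^sub>\<ge>\<^sub>0)\<^bsup>|e|\<^esup> \<rightarrow> \<real>\<^sub>\<ge>\<^sub>0\<close> are indexed by the members of
  \<open>e\<close>; they are the elements of \<open>e \<rightarrow>\<^sub>E {0..}\<close>, i.e. functions that are \<open>undefined\<close> outside \<open>e\<close>.
\<close>

record 'v game =
  nodes :: "'v set"
  hyperedges :: "'v set set"
  budget :: "'v \<Rightarrow> real"
  reward :: "'v set \<Rightarrow> ('v \<Rightarrow> real) \<Rightarrow> real"

definition nondecreasing_on :: "'v set \<Rightarrow> (('v \<Rightarrow> real) \<Rightarrow> real) \<Rightarrow> bool" where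
  "nondecreasing_on e g \<longleftrightarrow>
     (\<forall>x \<in> e \<rightarrow>\<^sub>E {0..}. \<forall>u\<in>e. \<forall>t\<ge>x u. g x \<le> g (x(u := t)))"

definition symmetric_on :: "'v set \<Rightarrow> (('v \<Rightarrow> real) \<Rightarrow> real) \<Rightarrow> bool" where
  "symmetric_on e g \<longleftrightarrow>
     (\<forall>x \<in> e \<rightarrow>\<^sub>E {0..}. \<forall>\<pi>. \<pi> permutes e \<longrightarrow> g (x \<circ> \<pi>) = g x)"

text \<open>
  Frechet differentiability. The function type is not a normed space, so the definition is
  written out in coordinates. Derivatives (here and in \<open>coordinate_convex\<close>) are taken in the
  interior of the orthant only; nothing about one-sided derivatives on the boundary is required.
\<close>

definition differentiable_inside :: "'v set \<Rightarrow> (('v \<Rightarrow> real) \<Rightarrow> real) \<Rightarrow> bool" where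
  "differentiable_inside e g \<longleftrightarrow>
     (\<forall>x \<in> e \<rightarrow>\<^sub>E {0<..}. \<exists>d :: 'v \<Rightarrow> real.
        ((\<lambda>y. (g y - g x - (\<Sum>u\<in>e. d u * (y u - x u))) / L2_set (\<lambda>u. y u - x u) e) \<longlongrightarrow> 0)
          (at x within (e \<rightarrow>\<^sub>E {0<..})))"

text \<open>\<open>\<partial>\<^sup>2g/\<partial>x\<^sub>u\<^sup>2\<close> exists and is nonnegative, for every argument \<open>x\<^sub>u\<close>; \<open>g'\<close> is the first partial
  derivative along the line through \<open>x\<close> in direction \<open>u\<close>.\<close>

definition coordinate_convex :: "'v set \<Rightarrow> (('v \<Rightarrow> real) \<Rightarrow> real) \<Rightarrow> bool" where
  "coordinate_convex e g \<longleftrightarrow>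
     (\<forall>x \<in> e \<rightarrow>\<^sub>E {0<..}. \<forall>u\<in>e. \<exists>g' D.
        (\<forall>t>0. ((\<lambda>t. g (x(u := t))) has_real_derivative g' t) (at t)) \<and>
        (g' has_real_derivative D) (at (x u)) \<and> D \<ge> 0)"

definition contribution_game :: "'v game \<Rightarrow> bool" where
  "contribution_game G \<longleftrightarrow>
     finite (nodes G) \<and>
     (\<forall>e \<in> hyperedges G. e \<subseteq> nodes G) \<and>
     (\<forall>v \<in> nodes G. 0 \<le> budget G v) \<and>
     (\<forall>e \<in> hyperedges G.
        (\<forall>x \<in> e \<rightarrow>\<^sub>E {0..}. 0 \<le> reward G e x) \<and>
        nondecreasing_on e (reward G e) \<and>
        symmetric_on e (reward G e) \<and>
        continuous_on (e \<rightarrow>\<^sub>E {0..}) (reward G e) \<and>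
        differentiable_inside e (reward G e))"

definition incident :: "'v game \<Rightarrow> 'v \<Rightarrow> 'v set set" where
  "incident G v = {e \<in> hyperedges G. v \<in> e}"

definition strategy :: "'v game \<Rightarrow> 'v \<Rightarrow> ('v set \<Rightarrow> real) \<Rightarrow> bool" where
  "strategy G v \<sigma> \<longleftrightarrow> (\<forall>e \<in> incident G v. 0 \<le> \<sigma> e) \<and> (\<Sum>e \<in> incident G v. \<sigma> e) \<le> budget G v"

definition state :: "'v game \<Rightarrow> ('v \<Rightarrow> 'v set \<Rightarrow> real) \<Rightarrow> bool" where
  "state G s \<longleftrightarrow> (\<forall>v \<in> nodes G. strategy G v (s v))"

definition utility :: "'v game \<Rightarrow> ('v \<Rightarrow> 'v set \<Rightarrow> real) \<Rightarrow> 'v \<Rightarrow> real" where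
  "utility G s v = (\<Sum>e \<in> incident G v. reward G e (\<lambda>u\<in>e. s u e))"

definition setwise_equilibrium :: "'v game \<Rightarrow> ('v \<Rightarrow> 'v set \<Rightarrow> real) \<Rightarrow> bool" where
  "setwise_equilibrium G s \<longleftrightarrow>
     state G s \<and>
     (\<forall>e \<in> hyperedges G. \<forall>U. U \<subseteq> e \<longrightarrow> U \<noteq> {} \<longrightarrow>
        (\<forall>s'. (\<forall>u\<in>U. strategy G u (s' u)) \<longrightarrow>
              (\<exists>v\<in>U. utility G s v \<ge> utility G (override_on s s' U) v)))"

definition vanishing_on_zero :: "'v set \<Rightarrow> (('v \<Rightarrow> real) \<Rightarrow> real) \<Rightarrow> bool" where
  "vanishing_on_zero e g \<longleftrightarrow> (\<forall>x \<in> e \<rightarrow>\<^sub>E {0..}. (\<exists>u\<in>e. x u = 0) \<longrightarrow> g x = 0)"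

definition convex_zero_game :: "'v game \<Rightarrow> bool" where
  "convex_zero_game G \<longleftrightarrow>
     contribution_game G \<and>
     (\<forall>e \<in> hyperedges G. coordinate_convex e (reward G e) \<and> vanishing_on_zero e (reward G e))"


section \<open>Polynomial-time computation\<close>

text \<open>
  Budgets and rewards are real numbers and the reward functions are arbitrary, so the machine is
  a real RAM that reads budgets from memory and accesses the reward functions through a value
  oracle. Programs are finite texts, fixed independently of the input, over a fixed finite number
  of arrays of natural numbers and of reals; indices into the arrays are computed. Every
  assignment, oracle query and test of a condition takes one time unit. There is no
  multiplication, division or rounding, and no real constant other than 0 and 1, so that unit
  cost cannot hide superpolynomial work.
\<close>

datatype nexp = NConst nat | NArr nat nexp | NAdd nexp nexp | NSub nexp nexp

datatype rexp = RZero | ROne | RArr nat nexp | RAdd rexp rexp | RSub rexp rexp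

datatype cond = NLess nexp nexp | RLess rexp rexp | CNot cond | CAnd cond cond

datatype prog =
    Skip
  | NAssign nat nexp nexp
  | RAssign nat nexp rexp
  | Query nat nexp nexp nat
  | Seq prog prog
  | IfElse cond prog prog
  | While cond prog

record memory =
  nmem :: "nat \<Rightarrow> nat \<Rightarrow> nat"
  rmem :: "nat \<Rightarrow> nat \<Rightarrow> real"

fun nval :: "memory \<Rightarrow> nexp \<Rightarrow> nat" where
  "nval M (NConst k) = k"
| "nval M (NArr a i) = nmem M a (nval M i)"
| "nval M (NAdd x y) = nval M x + nval M y"
| "nval M (NSub x y) = nval M x - nval M y"

fun rval :: "memory \<Rightarrow> rexp \<Rightarrow> real" where
  "rval M RZero = 0"
| "rval M ROne = 1"
| "rval M (RArr a i) = rmem M a (nval M i)"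
| "rval M (RAdd x y) = rval M x + rval M y"
| "rval M (RSub x y) = rval M x - rval M y"

fun cval :: "memory \<Rightarrow> cond \<Rightarrow> bool" where
  "cval M (NLess x y) = (nval M x < nval M y)"
| "cval M (RLess x y) = (rval M x < rval M y)"
| "cval M (CNot c) = (\<not> cval M c)"
| "cval M (CAnd c d) = (cval M c \<and> cval M d)"

definition nstore :: "nat \<Rightarrow> nat \<Rightarrow> nat \<Rightarrow> memory \<Rightarrow> memory" where
  "nstore a i k M = M\<lparr>nmem := (nmem M)(a := (nmem M a)(i := k))\<rparr>"

definition rstore :: "nat \<Rightarrow> nat \<Rightarrow> real \<Rightarrow> memory \<Rightarrow> memory" where
  "rstore a i r M = M\<lparr>rmem := (rmem M)(a := (rmem M a)(i := r))\<rparr>"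

text \<open>
  \<open>exec F c M t M'\<close>: program \<open>c\<close> started in \<open>M\<close> halts in \<open>M'\<close> after \<open>t\<close> time units. The oracle
  \<open>F j x\<close> returns the value of the \<open>j\<close>-th reward function; \<open>Query a i j b\<close> passes it the real array
  \<open>b\<close>, in which the effort of node \<open>u\<close> is stored at index \<open>u\<close>, and writes the answer to
  position \<open>i\<close> of the real array \<open>a\<close>.
\<close>

inductive exec ::
  "(nat \<Rightarrow> (nat \<Rightarrow> real) \<Rightarrow> real) \<Rightarrow> prog \<Rightarrow> memory \<Rightarrow> nat \<Rightarrow> memory \<Rightarrow> bool" for F where
  Skip: "exec F Skip M 1 M"
| NAssign: "exec F (NAssign a i x) M 1 (nstore a (nval M i) (nval M x) M)"
| RAssign: "exec F (RAssign a i x) M 1 (rstore a (nval M i) (rval M x) M)"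
| Query: "exec F (Query a i j b) M 1 (rstore a (nval M i) (F (nval M j) (rmem M b)) M)"
| Seq: "exec F c M t M' \<Longrightarrow> exec F d M' t' M'' \<Longrightarrow> exec F (Seq c d) M (t + t') M''"
| If_True: "cval M b \<Longrightarrow> exec F c M t M' \<Longrightarrow> exec F (IfElse b c d) M (1 + t) M'"
| If_False: "\<not> cval M b \<Longrightarrow> exec F d M t M' \<Longrightarrow> exec F (IfElse b c d) M (1 + t) M'"
| While_False: "\<not> cval M b \<Longrightarrow> exec F (While b c) M 1 M"
| While_True: "cval M b \<Longrightarrow> exec F c M t M' \<Longrightarrow> exec F (While b c) M' t' M'' \<Longrightarrow>
    exec F (While b c) M (1 + t + t') M''"

inductive_cases exec_elims:
  "exec F Skip M t M'" "exec F (NAssign a i x) M t M'" "exec F (RAssign a i x) M t M'"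
  "exec F (Query a i j b) M t M'" "exec F (Seq c d) M t M'" "exec F (IfElse b c d) M t M'"
  "exec F (While b c) M t M'"

lemma exec_deterministic:
  "exec F c M t M' \<Longrightarrow> exec F c M u N' \<Longrightarrow> u = t \<and> N' = M'"
proof (induction arbitrary: u N' rule: exec.induct)
  case Seq
  show ?case by (rule exec_elims(5)[OF Seq.prems]) (auto dest!: Seq.IH)
next
  case If_True
  show ?case
    by (rule exec_elims(6)[OF If_True.prems]) (auto dest!: If_True.IH simp: If_True.hyps)
next
  case If_False
  show ?case
    by (rule exec_elims(6)[OF If_False.prems]) (auto dest!: If_False.IH simp: If_False.hyps)
next
  case While_False
  show ?case by (rule exec_elims(7)[OF While_False.prems]) (auto simp: While_False.hyps)
next
  case While_True
  show ?case
    by (rule exec_elims(7)[OF While_True.prems]) (auto dest!: While_True.IH simp: While_True.hyps)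
qed (erule exec_elims(1-4), simp)+

text \<open>
  Input format: the nodes are \<open>0, \<dots>, n - 1\<close>, and the list \<open>es\<close> enumerates the hyperedges, each
  given as a list of its members.
\<close>

definition presents :: "nat \<Rightarrow> nat list list \<Rightarrow> nat game \<Rightarrow> bool" where
  "presents n es G \<longleftrightarrow>
     nodes G = {..<n} \<and>
     (\<forall>ms \<in> set es. distinct ms) \<and> distinct (map set es) \<and> set ` set es = hyperedges G"

definition input_size :: "nat \<Rightarrow> nat list list \<Rightarrow> nat" where
  "input_size n es = n + length es + length (concat es)"

text \<open>The members of the \<open>j\<close>-th hyperedge start at position \<open>offset es j\<close> of \<open>concat es\<close>.\<close>

definition offset :: "nat list list \<Rightarrow> nat \<Rightarrow> nat" where
  "offset es j = length (concat (take j es))"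

text \<open>
  Natural array 0 holds \<open>n\<close> and the number of hyperedges, array 1 the offsets, array 2 the
  concatenated member lists; real array 0 holds the budgets. All other cells are 0.
\<close>

definition initial_memory :: "nat \<Rightarrow> nat list list \<Rightarrow> nat game \<Rightarrow> memory" where
  "initial_memory n es G =
     \<lparr>nmem = (\<lambda>a i.
        if a = 0 \<and> i = 0 then n
        else if a = 0 \<and> i = 1 then length es
        else if a = 1 \<and> i \<le> length es then offset es i
        else if a = 2 \<and> i < length (concat es) then concat es ! i
        else 0),
      rmem = (\<lambda>a i. if a = 0 \<and> i < n then budget G i else 0)\<rparr>"

definition reward_oracle :: "nat list list \<Rightarrow> nat game \<Rightarrow> nat \<Rightarrow> (nat \<Rightarrow> real) \<Rightarrow> real" where
  "reward_oracle es G j x =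
     (if j < length es then reward G (set (es ! j)) (restrict x (set (es ! j))) else 0)"

text \<open>Output format: real array 1 is aligned with \<open>concat es\<close> and holds the effort of each member
  of each hyperedge on that hyperedge.\<close>

definition stores_state :: "nat list list \<Rightarrow> memory \<Rightarrow> (nat \<Rightarrow> nat set \<Rightarrow> real) \<Rightarrow> bool" where
  "stores_state es M s \<longleftrightarrow>
     (\<forall>j < length es. \<forall>i < length (es ! j).
        rmem M 1 (offset es j + i) = s (es ! j ! i) (set (es ! j)))"

definition polytime_computable ::
  "(nat game \<Rightarrow> bool) \<Rightarrow> (nat game \<Rightarrow> (nat \<Rightarrow> nat set \<Rightarrow> real) \<Rightarrow> bool) \<Rightarrow> bool" where
  "polytime_computable C S \<longleftrightarrow>
     (\<exists>(c :: prog) (p :: nat poly). \<forall>G n es. C G \<longrightarrow> presents n es G \<longrightarrow>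
        (\<exists>t M. exec (reward_oracle es G) c (initial_memory n es G) t M \<and>
               t \<le> poly p (input_size n es) \<and>
               (\<exists>s. S G s \<and> stores_state es M s)))"

end

theory Submission
  imports Defs
begin

text \<open>
  Let \<open>R\<^sub>e\<close> be the reward of \<open>e\<close> when all its members spend their whole budget on it. Going
  through the hyperedges by decreasing \<open>R\<^sub>e\<close> and selecting those disjoint from all earlier
  selections yields a matching such that every nonempty hyperedge \<open>e\<close> meets a selected \<open>d\<close> with
  \<open>R\<^sub>e \<le> R\<^sub>d\<close>. Everybody spends the whole budget on the selected hyperedge, if there is one.

  For a coalition \<open>U\<close>, let \<open>v \<in> U\<close> have maximal utility \<open>w\<^sub>v\<close>. After any deviation of \<open>U\<close>, a hyperedge
  \<open>e \<ni> v\<close> either contains a player outside \<open>U\<close> who is matched elsewhere and so makes its reward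
  vanish, or \<open>R\<^sub>e \<le> w\<^sub>v\<close>. In the second case convexity in the effort of \<open>v\<close>, together with the value
  0 at effort 0, bounds the reward by the fraction of \<open>B\<^sub>v\<close> spent on \<open>e\<close> times \<open>w\<^sub>v\<close>. These fractions
  sum to at most 1, so \<open>v\<close> does not gain.
\<close>

section \<open>Rewards of convex games\<close>

text \<open>\<open>coordinate_convex\<close> supplies a derivative \<open>g'\<close> that may depend
  on the point. Uniqueness of derivatives merges these into one \<open>h'\<close> along the line,
  and the second-derivative criterion applies to it.\<close>

lemma coordinate_convex_convex_on:
  assumes "coordinate_convex e g" "x \<in> e \<rightarrow>\<^sub>E {0<..}" "u \<in> e"
  shows "convex_on {0<..} (\<lambda>t. g (x(u := t)))"
proof -
  let ?h = "\<lambda>t. g (x(u := t))"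
  have ex: "\<exists>g' D. (\<forall>t>0. (?h has_real_derivative g' t) (at t)) \<and>
        (g' has_real_derivative D) (at s) \<and> D \<ge> 0" if "s > 0" for s
  proof -
    have "x(u := s) \<in> e \<rightarrow>\<^sub>E {0<..}"
      using assms(2,3) that by (auto simp: PiE_iff extensional_def)
    from assms(1)[unfolded coordinate_convex_def, rule_format, OF this assms(3)]
    show ?thesis by simp
  qed
  obtain h' where h': "\<And>t. t > 0 \<Longrightarrow> (?h has_real_derivative h' t) (at t)"
    using ex[of 1] by auto
  have ex2: "\<exists>D. (h' has_real_derivative D) (at s) \<and> D \<ge> 0" if s: "s > 0" for s
  proof -
    obtain g' D where g': "\<forall>t>0. (?h has_real_derivative g' t) (at t)"
      and D: "(g' has_real_derivative D) (at s)" "D \<ge> 0" using ex[OF s] by blast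
    have "g' t = h' t" if "t \<in> {0<..}" for t
      using g' h'[of t] that by (intro DERIV_unique[of ?h _ t]) auto
    then have "(h' has_real_derivative D) (at s)"
      using has_field_derivative_transform_within_open[OF D(1), of "{0<..}" h'] s by simp
    with D show ?thesis by blast
  qed
  obtain h'' where h'': "\<And>s. s > 0 \<Longrightarrow> (h' has_real_derivative h'' s) (at s) \<and> h'' s \<ge> 0"
    by (rule that[of "\<lambda>s. SOME D. (h' has_real_derivative D) (at s) \<and> D \<ge> 0"])
      (rule someI_ex[OF ex2])
  show ?thesis
    by (rule f''_ge0_imp_convex[where f' = h' and f'' = h'']) (use h' h'' in auto)
qed

text \<open>A convex function vanishing at 0 lies below its chord from 0 to \<open>b\<close>.
  Convexity is known only in the interior, so the chord starts at a small \<open>y > 0\<close> and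
  continuity moves the inequality to \<open>y = 0\<close>.\<close>

lemma reward_le_share:
  assumes cc: "coordinate_convex e g" and van: "vanishing_on_zero e g"
    and cont: "continuous_on (e \<rightarrow>\<^sub>E {0..}) g"
    and nonneg: "\<And>x. x \<in> e \<rightarrow>\<^sub>E {0..} \<Longrightarrow> 0 \<le> g x"
    and x: "x \<in> e \<rightarrow>\<^sub>E {0..}" and u: "u \<in> e" and b: "x u \<le> b" "0 < b"
  shows "g x \<le> x u / b * g (x(u := b))"
\<comment> \<open>On the boundary the line through \<open>x\<close> may miss the interior, but there
  the left side is 0.\<close>
proof (cases "\<exists>w\<in>e. x w = 0")
  case True
  then have "g x = 0" using van x by (auto simp: vanishing_on_zero_def)
  moreover have "x(u := b) \<in> e \<rightarrow>\<^sub>E {0..}" using x u b by (auto simp: PiE_iff extensional_def)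
  moreover have "0 \<le> x u" using x u by auto
  ultimately show ?thesis using nonneg b by simp
next
  case False
  then have "0 < x w" if "w \<in> e" for w
    using PiE_mem[OF x that] that by (auto simp: less_le)
  then have pos: "x \<in> e \<rightarrow>\<^sub>E {0<..}" using x by (auto simp: PiE_iff)
  define h where "h = (\<lambda>t. g (x(u := t)))"
  define l where "l = x u / b"
  have xu: "0 < x u" using pos u by auto
  have l: "0 < l" "l \<le> 1" using xu b by (auto simp: l_def)
  have conv: "convex_on {0<..} h"
    unfolding h_def by (rule coordinate_convex_convex_on[OF cc pos u])
  have conth: "continuous_on {0..} h"
    unfolding h_def
  proof (rule continuous_on_compose2[OF cont])
    show "continuous_on {0..} (\<lambda>t. x(u := t))"
    proof (rule continuous_on_coordinatewise_then_product)
      show "continuous_on {0..} (\<lambda>t. (x(u := t)) i)" for i by (cases "i = u") auto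
    qed
    show "(\<lambda>t. x(u := t)) ` {0..} \<subseteq> e \<rightarrow>\<^sub>E {0..}"
      using x u by (auto simp: PiE_iff extensional_def)
  qed
  have h0: "h 0 = 0"
  proof -
    have "x(u := 0) \<in> e \<rightarrow>\<^sub>E {0..}" using x u by (auto simp: PiE_iff extensional_def)
    moreover have "\<exists>w\<in>e. (x(u := 0)) w = 0" using u by auto
    ultimately show ?thesis using van unfolding vanishing_on_zero_def h_def by blast
  qed
  have "(h \<longlongrightarrow> h 0) (at 0 within {0..})" using conth by (simp add: continuous_on)
  then have lim: "(h \<longlongrightarrow> 0) (at_right 0)"
    unfolding h0 by (rule tendsto_within_subset) auto
  \<comment> \<open>Convexity between \<open>y\<close> and \<open>b\<close> with weight
    \<open>l = x u / b\<close>; as \<open>y\<close> tends to 0, the combination tends to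
    \<open>l * b = x u\<close>.\<close>
  have ev: "\<forall>\<^sub>F y in at_right 0. h ((1 - l) * y + l * b) \<le> (1 - l) * h y + l * h b"
    unfolding eventually_at_filter
    by (intro always_eventually) (use convex_onD[OF conv, of l _ b] l b in auto)
  have "((\<lambda>y. (1 - l) * y + l * b) \<longlongrightarrow> l * b) (at_right 0)"
    by (auto intro!: tendsto_eq_intros)
  moreover have "isCont h (l * b)"
    using conth l b by (intro continuous_on_interior[of "{0..}"]) auto
  ultimately have "((\<lambda>y. h ((1 - l) * y + l * b)) \<longlongrightarrow> h (l * b)) (at_right 0)"
    by (rule isCont_tendsto_compose[rotated])
  moreover have "((\<lambda>y. (1 - l) * h y + l * h b) \<longlongrightarrow> (1 - l) * 0 + l * h b) (at_right 0)"
    by (intro tendsto_intros lim)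
  ultimately have "h (l * b) \<le> (1 - l) * 0 + l * h b"
    using ev by (intro tendsto_le) auto
  moreover have "l * b = x u" using b by (simp add: l_def)
  ultimately show ?thesis by (simp add: h_def l_def)
qed

text \<open>The definition raises one argument at a time, so \<open>x\<close> is turned into
  \<open>y\<close> coordinate by coordinate; \<open>A\<close> collects those already
  replaced.\<close>

lemma nondecreasing_on_mono:
  assumes mono: "nondecreasing_on e g" and "finite e"
    and x: "x \<in> e \<rightarrow>\<^sub>E {0..}" and y: "y \<in> e \<rightarrow>\<^sub>E {0..}" and le: "\<And>u. u \<in> e \<Longrightarrow> x u \<le> y u"
  shows "g x \<le> g y"
proof -
  have "g x \<le> g (override_on x y A)" if "finite A" "A \<subseteq> e" for A
    using that
  proof (induction A)
    case empty
    show ?case by simp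
  next
    case (insert a A)
    have z: "override_on x y A \<in> e \<rightarrow>\<^sub>E {0..}"
      using x y by (auto simp: PiE_iff override_on_def extensional_def)
    have "override_on x y (insert a A) = (override_on x y A)(a := y a)"
      by (auto simp: override_on_def)
    moreover have "override_on x y A a \<le> y a" using insert le by (auto simp: override_on_def)
    ultimately have "g (override_on x y A) \<le> g (override_on x y (insert a A))"
      using mono z insert.prems by (simp add: nondecreasing_on_def)
    with insert show ?case by simp
  qed
  from this[OF \<open>finite e\<close>] have "g x \<le> g (override_on x y e)" by simp
  also have "override_on x y e = y"
    using x y by (auto simp: override_on_def PiE_iff extensional_def)
  finally show ?thesis .
qed

section \<open>Stable matchings of hyperedges\<close>

lemma finite_ex_maximal_value:
  fixes f :: "'a \<Rightarrow> 'b::linorder"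
  assumes "finite A" "A \<noteq> {}"
  obtains b where "b \<in> A" "\<And>a. a \<in> A \<Longrightarrow> f a \<le> f b"
proof -
  have "Max (f ` A) \<in> f ` A" using assms by (intro Max_in) auto
  then obtain b where b: "b \<in> A" "f b = Max (f ` A)" by auto
  then have "f a \<le> f b" if "a \<in> A" for a using that assms by simp
  with b(1) show ?thesis by (rule that)
qed

section \<open>From stable matchings to setwise equilibria\<close>

definition full_reward :: "'v game \<Rightarrow> 'v set \<Rightarrow> real" where
  "full_reward G e = reward G e (restrict (budget G) e)"

definition matching_profile :: "'v game \<Rightarrow> 'v set set \<Rightarrow> 'v \<Rightarrow> 'v set \<Rightarrow> real" where
  "matching_profile G M v e = (if e \<in> M \<and> v \<in> e then budget G v else 0)"

lemma matching_profile_state: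
  assumes "contribution_game G" "pairwise disjnt M"
  shows "state G (matching_profile G M)"
  unfolding state_def strategy_def
proof (intro ballI conjI)
  fix v assume v: "v \<in> nodes G"
  then have bv: "0 \<le> budget G v" using assms by (auto simp: contribution_game_def)
  show "0 \<le> matching_profile G M v e" for e using bv by (auto simp: matching_profile_def)
  show "sum (matching_profile G M v) (incident G v) \<le> budget G v"
  proof (cases "\<exists>d\<in>incident G v. d \<in> M")
    case True
    then obtain d where d: "d \<in> incident G v" "d \<in> M" by blast
    have "finite (hyperedges G)"
      using assms(1) finite_subset[of "hyperedges G" "Pow (nodes G)"]
      by (auto simp: contribution_game_def)
    then have fin: "finite (incident G v)" by (simp add: incident_def)
    have zero: "matching_profile G M v e = 0" if "e \<in> incident G v - {d}" for e
      using that d assms(2) by (auto simp: matching_profile_def incident_def pairwise_def disjnt_def)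
    then have "sum (matching_profile G M v) (incident G v) = matching_profile G M v d"
      using sum.remove[OF fin d(1), of "matching_profile G M v"] by (simp add: sum.neutral zero)
    then show ?thesis using bv by (simp add: matching_profile_def)
  next
    case False
    then have "sum (matching_profile G M v) (incident G v) = 0"
      by (intro sum.neutral) (auto simp: matching_profile_def)
    with bv show ?thesis by simp
  qed
qed

text \<open>\<open>stable\<close> is stability of a matching when hyperedges are ranked by full
  reward. It makes every hyperedge at the best-off coalition member either worthless after the
  deviation or of full reward at most that member's utility.\<close>

lemma stable_matching_equilibrium:
  assumes G: "convex_zero_game G" and M: "M \<subseteq> hyperedges G" "pairwise disjnt M"
    and stable: "\<And>e. e \<in> hyperedges G \<Longrightarrow> e \<noteq> {} \<Longrightarrow>
      \<exists>d\<in>M. e \<inter> d \<noteq> {} \<and> full_reward G e \<le> full_reward G d"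
  shows "setwise_equilibrium G (matching_profile G M)"
proof -
  let ?s = "matching_profile G M"
  have cg: "contribution_game G" using G by (simp add: convex_zero_game_def)
  have fin: "finite (nodes G)" using cg by (simp add: contribution_game_def)
  have sub: "\<And>e. e \<in> hyperedges G \<Longrightarrow> e \<subseteq> nodes G" using cg by (auto simp: contribution_game_def)
  have bnn: "\<And>v. v \<in> nodes G \<Longrightarrow> 0 \<le> budget G v" using cg by (auto simp: contribution_game_def)
  have finH: "finite (hyperedges G)"
    using sub fin by (intro finite_subset[of "hyperedges G" "Pow (nodes G)"]) auto
  have fini: "finite (incident G v)" for v using finH by (simp add: incident_def)
  have state: "state G ?s" by (rule matching_profile_state[OF cg M(2)])
  have nn: "0 \<le> reward G e x" if "e \<in> hyperedges G" "x \<in> e \<rightarrow>\<^sub>E {0..}" for e x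
    using cg that by (auto simp: contribution_game_def)
  have van: "reward G e x = 0" if "e \<in> hyperedges G" "x \<in> e \<rightarrow>\<^sub>E {0..}" "w \<in> e" "x w = 0" for e x w
    using G that by (auto simp: convex_zero_game_def vanishing_on_zero_def)
  have snn: "(\<lambda>u\<in>e. s u e) \<in> e \<rightarrow>\<^sub>E {0..}" if "state G s" "e \<in> hyperedges G" for s e
    using that sub by (auto simp: state_def strategy_def incident_def)
  have unn: "0 \<le> utility G ?s v" for v
    unfolding utility_def using nn snn[OF state] by (intro sum_nonneg) (auto simp: incident_def)
  have ufull: "full_reward G d \<le> utility G ?s w" if "d \<in> M" "w \<in> d" for d w
  proof -
    have "full_reward G d = reward G d (\<lambda>u\<in>d. ?s u d)"
      unfolding full_reward_def using that
      by (intro arg_cong[where f = "reward G d"]) (auto simp: matching_profile_def)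
    also have "\<dots> \<le> utility G ?s w"
      unfolding utility_def
      by (rule member_le_sum) (use that M fini nn snn[OF state] in \<open>auto simp: incident_def\<close>)
    finally show ?thesis .
  qed
  have "\<exists>v\<in>U. utility G ?s v \<ge> utility G (override_on ?s s' U) v"
    if e: "e \<in> hyperedges G" and U: "U \<subseteq> e" "U \<noteq> {}" and s': "\<forall>u\<in>U. strategy G u (s' u)" for e U s'
  proof -
    let ?t = "override_on ?s s' U"
    \<comment> \<open>Maximality over \<open>U\<close> bounds the full reward of any selected
      hyperedge meeting \<open>U\<close> by the utility of \<open>v\<close>.\<close>
    have "finite U" by (rule finite_subset[of U "nodes G"]) (use U(1) sub[OF e] fin in auto)
    then obtain v where v: "v \<in> U" and vmax: "\<And>w. w \<in> U \<Longrightarrow> utility G ?s w \<le> utility G ?s v"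
      by (rule finite_ex_maximal_value[OF _ U(2), of "utility G ?s"]) (rule that)
    have vn: "v \<in> nodes G" using v U e sub by blast
    have statet: "state G ?t" using state s' by (auto simp: state_def override_on_def)
    have tle: "?t u d \<le> budget G u" if "d \<in> incident G u" "u \<in> nodes G" for u d
    proof -
      have "strategy G u (?t u)" using statet that by (auto simp: state_def)
      then have "?t u d \<le> sum (?t u) (incident G u)" "sum (?t u) (incident G u) \<le> budget G u"
        using that fini by (auto simp: strategy_def intro!: member_le_sum)
      then show ?thesis by simp
    qed
    have "utility G ?t v \<le> utility G ?s v"
    \<comment> \<open>The shares below divide by \<open>budget G v\<close>; with budget 0 all
      efforts of \<open>v\<close>, hence all its rewards, vanish.\<close>
    proof (cases "budget G v = 0")
      case True
      have "reward G d (\<lambda>u\<in>d. ?t u d) = 0" if "d \<in> incident G v" for d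
      proof -
        have "?t v d = 0"
          using tle[OF that vn] True statet vn that
          by (auto simp: state_def strategy_def intro!: antisym)
        then show ?thesis using that snn[OF statet] by (intro van[of _ _ v]) (auto simp: incident_def)
      qed
      then have "utility G ?t v = 0" by (simp add: utility_def)
      with unn show ?thesis by simp
    next
      case False
      then have bv: "budget G v > 0" using bnn[OF vn] by simp
      have bound: "reward G d (\<lambda>u\<in>d. ?t u d) \<le> ?t v d / budget G v * utility G ?s v"
        if d: "d \<in> incident G v" for d
      proof -
        have dH: "d \<in> hyperedges G" and vd: "v \<in> d" using d by (auto simp: incident_def)
        define x where "x = (\<lambda>u\<in>d. ?t u d)"
        have x: "x \<in> d \<rightarrow>\<^sub>E {0..}" unfolding x_def by (rule snn[OF statet dH])
        have xv: "x v = ?t v d" "0 \<le> x v" "x v \<le> budget G v"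
          using vd x tle[OF d vn] by (auto simp: x_def)
        obtain c w where c: "c \<in> M" "w \<in> d" "w \<in> c" "full_reward G d \<le> full_reward G c"
          using stable[OF dH] vd by blast
        show ?thesis
        \<comment> \<open>If \<open>w\<close> does not deviate and \<open>c\<close> differs from
          \<open>d\<close>, disjointness keeps \<open>d\<close> out of \<open>M\<close>, so
          \<open>w\<close> contributes nothing to \<open>d\<close>.\<close>
        proof (cases "w \<notin> U \<and> c \<noteq> d")
          case True
          have "d \<notin> M" using True c M(2) by (auto simp: pairwise_def disjnt_def)
          then have "x w = 0" using True c by (simp add: x_def override_on_def matching_profile_def)
          then have "reward G d x = 0" using van[OF dH x c(2)] by simp
          then show ?thesis using xv bv unn[of v] by (simp add: x_def)
        next
          case False
          \<comment> \<open>Either \<open>w\<close> is a coalition member earning at least the full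
            reward of \<open>c\<close>, or \<open>c = d\<close> and \<open>v\<close> itself earns
            the full reward of \<open>d\<close>.\<close>
          have fd: "full_reward G d \<le> utility G ?s v"
          proof (cases "w \<in> U")
            case True
            then show ?thesis using c ufull[OF c(1,3)] vmax[OF True] by linarith
          next
            case nU: False
            then show ?thesis using False c ufull[of d v] vd by simp
          qed
          have share: "reward G d x \<le> x v / budget G v * reward G d (x(v := budget G v))"
          proof (rule reward_le_share[where e = d and g = "reward G d"])
            show "continuous_on (d \<rightarrow>\<^sub>E {0..}) (reward G d)" "coordinate_convex d (reward G d)"
              "vanishing_on_zero d (reward G d)"
              using G dH by (auto simp: convex_zero_game_def contribution_game_def)
          qed (use nn[OF dH] x vd xv bv in auto)
          \<comment> \<open>After \<open>v\<close> is raised to its budget, monotonicity raises the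
            other players to theirs.\<close>
          have "reward G d (x(v := budget G v)) \<le> full_reward G d"
            unfolding full_reward_def
          proof (rule nondecreasing_on_mono[where e = d and g = "reward G d"])
            show "nondecreasing_on d (reward G d)" using cg dH by (auto simp: contribution_game_def)
            show "finite d" by (rule finite_subset[OF sub[OF dH] fin])
            show "x(v := budget G v) \<in> d \<rightarrow>\<^sub>E {0..}"
              using x vd bv by (auto simp: PiE_iff extensional_def)
            show "restrict (budget G) d \<in> d \<rightarrow>\<^sub>E {0..}"
              using bnn sub[OF dH] by auto
            show "(x(v := budget G v)) u \<le> restrict (budget G) d u" if "u \<in> d" for u
              using that tle[of d u] dH sub[OF dH] by (auto simp: x_def incident_def)
          qed
          with fd have "x v / budget G v * reward G d (x(v := budget G v))
              \<le> x v / budget G v * utility G ?s v"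
            using xv bv by (intro mult_left_mono) auto
          with share show ?thesis using xv by (simp add: x_def)
        qed
      qed
      have "utility G ?t v \<le> (\<Sum>d\<in>incident G v. ?t v d / budget G v * utility G ?s v)"
        unfolding utility_def[of G ?t] by (intro sum_mono bound)
      also have "\<dots> = (\<Sum>d\<in>incident G v. ?t v d) / budget G v * utility G ?s v"
        by (simp add: sum_distrib_right sum_divide_distrib)
      also have "\<dots> \<le> 1 * utility G ?s v"
        using statet vn bv unn[of v]
        by (intro mult_right_mono) (auto simp: state_def strategy_def)
      finally show ?thesis by simp
    qed
    with v show ?thesis by blast
  qed
  with state show ?thesis by (auto simp: setwise_equilibrium_def)
qed

section \<open>Greedy selection of hyperedges\<close>

text \<open>\<open>D\<close> is the processed and \<open>S\<close> the selected part of the index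
  set \<open>I\<close>. Indexing by \<open>E\<close> covers both hyperedges indexed by themselves
  and positions in an input list.\<close>

definition greedy_stage ::
  "('i \<Rightarrow> 'v set) \<Rightarrow> ('i \<Rightarrow> real) \<Rightarrow> 'i set \<Rightarrow> 'i set \<Rightarrow> 'i set \<Rightarrow> bool" where
  "greedy_stage E r I D S \<longleftrightarrow> S \<subseteq> D \<and> D \<subseteq> I \<and>
     (\<forall>i\<in>D. \<forall>j\<in>I - D. r j \<le> r i) \<and>
     (\<forall>i\<in>S. \<forall>j\<in>S. i \<noteq> j \<longrightarrow> E i \<inter> E j = {}) \<and>
     (\<forall>i\<in>D. E i \<noteq> {} \<longrightarrow> (\<exists>d\<in>S. E i \<inter> E d \<noteq> {} \<and> r i \<le> r d))"

lemma greedy_stage_empty: "greedy_stage E r I {} {}"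
  by (simp add: greedy_stage_def)

text \<open>A nonempty new selection is its own witness in the last clause; maximality of
  \<open>b\<close> preserves the ordering clause.\<close>

lemma greedy_stage_select:
  assumes "greedy_stage E r I D S" "b \<in> I - D" "\<And>j. j \<in> I - D \<Longrightarrow> r j \<le> r b"
    and "E b \<inter> \<Union>(E ` S) = {}"
  shows "greedy_stage E r I (insert b D) (insert b S)"
proof -
  have S: "S \<subseteq> D" "D \<subseteq> I"
    and le: "\<And>i j. i \<in> D \<Longrightarrow> j \<in> I - D \<Longrightarrow> r j \<le> r i"
    and disj: "\<And>i j. i \<in> S \<Longrightarrow> j \<in> S \<Longrightarrow> i \<noteq> j \<Longrightarrow> E i \<inter> E j = {}"
    and blk: "\<And>i. i \<in> D \<Longrightarrow> E i \<noteq> {} \<Longrightarrow> \<exists>d\<in>S. E i \<inter> E d \<noteq> {} \<and> r i \<le> r d"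
    using assms(1) by (simp_all add: greedy_stage_def)
  have "\<exists>d\<in>insert b S. E i \<inter> E d \<noteq> {} \<and> r i \<le> r d" if "i \<in> insert b D" "E i \<noteq> {}" for i
    using blk[of i] that by auto
  moreover have "E i \<inter> E j = {}" if "i \<in> insert b S" "j \<in> insert b S" "i \<noteq> j" for i j
    using disj[of i j] that assms(4) by (auto simp: Int_commute)
  moreover have "r j \<le> r i" if "i \<in> insert b D" "j \<in> I - insert b D" for i j
    using le[of i j] assms(3)[of j] that by auto
  ultimately show ?thesis
    unfolding greedy_stage_def using S assms(2) by (intro conjI ballI impI) auto
qed

text \<open>A selected \<open>d\<close> meeting \<open>b\<close> was processed while
  \<open>b\<close> was pending, so \<open>r b \<le> r d\<close> and \<open>d\<close> is the witness
  for \<open>b\<close>.\<close>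

lemma greedy_stage_skip:
  assumes "greedy_stage E r I D S" "b \<in> I - D" "\<And>j. j \<in> I - D \<Longrightarrow> r j \<le> r b"
    and "E b \<inter> \<Union>(E ` S) \<noteq> {}"
  shows "greedy_stage E r I (insert b D) S"
proof -
  have S: "S \<subseteq> D" "D \<subseteq> I"
    and le: "\<And>i j. i \<in> D \<Longrightarrow> j \<in> I - D \<Longrightarrow> r j \<le> r i"
    and disj: "\<forall>i\<in>S. \<forall>j\<in>S. i \<noteq> j \<longrightarrow> E i \<inter> E j = {}"
    and blk: "\<And>i. i \<in> D \<Longrightarrow> E i \<noteq> {} \<Longrightarrow> \<exists>d\<in>S. E i \<inter> E d \<noteq> {} \<and> r i \<le> r d"
    using assms(1) by (simp_all add: greedy_stage_def)
  obtain d where d: "d \<in> S" "E b \<inter> E d \<noteq> {}" using assms(4) by blast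
  have "r b \<le> r d" using le[of d b] d(1) S assms(2) by auto
  then have "\<exists>d\<in>S. E i \<inter> E d \<noteq> {} \<and> r i \<le> r d" if "i \<in> insert b D" "E i \<noteq> {}" for i
    using blk[of i] that d by auto
  moreover have "r j \<le> r i" if "i \<in> insert b D" "j \<in> I - insert b D" for i j
    using le[of i j] assms(3)[of j] that by auto
  ultimately show ?thesis
    unfolding greedy_stage_def using S assms(2) disj by (intro conjI) auto
qed

text \<open>An abstract greedy run, processing one maximal pending index per step; it yields
  existence for arbitrary node types.\<close>

lemma greedy_stage_exists:
  fixes r :: "'i \<Rightarrow> real"
  assumes "finite I"
  shows "\<exists>S. greedy_stage E r I I S"
proof -
  have "\<exists>D S. greedy_stage E r I D S \<and> card D = k" if "k \<le> card I" for k
    using that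
  proof (induction k)
    case 0
    show ?case using greedy_stage_empty[of E r I] by (intro exI[of _ "{}"]) auto
  next
    case (Suc k)
    then obtain D S where DS: "greedy_stage E r I D S" "card D = k" by auto
    then have DI: "D \<subseteq> I" by (simp add: greedy_stage_def)
    have "I - D \<noteq> {}" using DS DI Suc.prems by auto
    then obtain b where b: "b \<in> I - D" "\<And>j. j \<in> I - D \<Longrightarrow> r j \<le> r b"
      by (rule finite_ex_maximal_value[of "I - D" r, OF finite_Diff[OF assms]]) (rule that)
    have "\<exists>S'. greedy_stage E r I (insert b D) S'"
    proof (cases "E b \<inter> \<Union>(E ` S) = {}")
      case True
      show ?thesis by (rule exI, rule greedy_stage_select[OF DS(1) b True])
    next
      case False
      show ?thesis by (rule exI, rule greedy_stage_skip[OF DS(1) b False])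
    qed
    moreover have "card (insert b D) = Suc k"
      using b DS finite_subset[OF DI assms] by simp
    ultimately show ?case by blast
  qed
  from this[of "card I"] obtain D S where "greedy_stage E r I D S" "card D = card I" by auto
  moreover from this have "D = I" using assms by (intro card_subset_eq) (auto simp: greedy_stage_def)
  ultimately show ?thesis by blast
qed

text \<open>Once everything is processed, the last clause of \<open>greedy_stage\<close> is the
  stability hypothesis. Distinct selected sets come from distinct indices and so are
  disjoint.\<close>

lemma greedy_equilibrium:
  assumes "convex_zero_game G" "E ` I = hyperedges G"
    and "greedy_stage E (\<lambda>i. full_reward G (E i)) I I S"
  shows "setwise_equilibrium G (matching_profile G (E ` S))"
proof (rule stable_matching_equilibrium)
  show "E ` S \<subseteq> hyperedges G" using assms by (auto simp: greedy_stage_def)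
  show "pairwise disjnt (E ` S)"
    using assms(3) unfolding greedy_stage_def pairwise_def disjnt_def by (metis imageE)
  show "\<exists>d\<in>E ` S. e \<inter> d \<noteq> {} \<and> full_reward G e \<le> full_reward G d"
    if "e \<in> hyperedges G" "e \<noteq> {}" for e
  proof -
    have "e \<in> E ` I" using that assms(2) by simp
    then obtain i where "i \<in> I" "e = E i" by auto
    then show ?thesis using that assms(3) by (simp add: greedy_stage_def)
  qed
qed (rule assms)

section \<open>Timed Hoare triples\<close>

text \<open>Termination is part of the claim, and \<open>k\<close> is only an upper bound, so
  branches of different cost can share it.\<close>

definition hoare where
  "hoare F P c k Q \<longleftrightarrow> (\<forall>M. P M \<longrightarrow> (\<exists>t M'. exec F c M t M' \<and> t \<le> k \<and> Q M'))"

lemma hoare_conseq: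
  assumes "hoare F P' c k' Q'" "\<And>M. P M \<Longrightarrow> P' M" "\<And>M. Q' M \<Longrightarrow> Q M" "k' \<le> k"
  shows "hoare F P c k Q"
  using assms unfolding hoare_def by (meson order_trans)

lemma hoare_ex:
  assumes "\<And>x. hoare F (P x) c k Q"
  shows "hoare F (\<lambda>M. \<exists>x. P x M) c k Q"
  using assms unfolding hoare_def by blast

lemma hoare_skip: "(\<And>M. P M \<Longrightarrow> Q M) \<Longrightarrow> hoare F P Skip 1 Q"
  unfolding hoare_def by (blast intro: exec.Skip)

lemma hoare_nassign:
  "(\<And>M. P M \<Longrightarrow> Q (nstore a (nval M i) (nval M x) M)) \<Longrightarrow> hoare F P (NAssign a i x) 1 Q"
  unfolding hoare_def by (blast intro: exec.NAssign)

lemma hoare_rassign: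
  "(\<And>M. P M \<Longrightarrow> Q (rstore a (nval M i) (rval M x) M)) \<Longrightarrow> hoare F P (RAssign a i x) 1 Q"
  unfolding hoare_def by (blast intro: exec.RAssign)

lemma hoare_query:
  "(\<And>M. P M \<Longrightarrow> Q (rstore a (nval M i) (F (nval M j) (rmem M b)) M)) \<Longrightarrow>
    hoare F P (Query a i j b) 1 Q"
  unfolding hoare_def by (blast intro: exec.Query)

lemma hoare_seq:
  assumes "hoare F P c k Q" "hoare F Q d l R"
  shows "hoare F P (Seq c d) (k + l) R"
  using assms unfolding hoare_def by (meson exec.Seq add_mono)

lemma hoare_if:
  assumes "hoare F (\<lambda>M. P M \<and> cval M b) c k Q" "hoare F (\<lambda>M. P M \<and> \<not> cval M b) d k Q"
  shows "hoare F P (IfElse b c d) (1 + k) Q"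
  unfolding hoare_def
proof (intro allI impI)
  fix M assume P: "P M"
  show "\<exists>t M'. exec F (IfElse b c d) M t M' \<and> t \<le> 1 + k \<and> Q M'"
  proof (cases "cval M b")
    case True
    with P assms(1) obtain t M' where "exec F c M t M'" "t \<le> k" "Q M'"
      unfolding hoare_def by blast
    with exec.If_True[of M b F c t M' d] True show ?thesis by (intro exI[of _ "1 + t"]) auto
  next
    case False
    with P assms(2) obtain t M' where "exec F d M t M'" "t \<le> k" "Q M'"
      unfolding hoare_def by blast
    with exec.If_False[of M b F d t M' c] False show ?thesis by (intro exI[of _ "1 + t"]) auto
  qed
qed

text \<open>Each round costs the body plus one unit for the test; the final failing test adds one.
  The induction is on the number of remaining rounds, hence the index \<open>N - k\<close>.\<close>

lemma hoare_for:
  assumes body: "\<And>k. k < N \<Longrightarrow> hoare F (I k) c l (I (Suc k))"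
    and cond: "\<And>k M. k \<le> N \<Longrightarrow> I k M \<Longrightarrow> cval M b \<longleftrightarrow> k < N"
  shows "hoare F (I 0) (While b c) (N * (l + 1) + 1) (I N)"
proof -
  have "hoare F (I (N - k)) (While b c) (k * (l + 1) + 1) (I N)" if "k \<le> N" for k
    using that
  proof (induction k)
    case 0
    have "exec F (While b c) M 1 M" if "I N M" for M
      using cond[of N] that by (intro exec.While_False) simp
    then show ?case unfolding hoare_def by (metis diff_zero le_add2)
  next
    case (Suc k)
    let ?i = "N - Suc k"
    have i: "?i < N" "Suc ?i = N - k" using Suc.prems by auto
    show ?case unfolding hoare_def
    proof (intro allI impI)
      fix M assume I: "I ?i M"
      then obtain t M' where 1: "exec F c M t M'" "t \<le> l" "I (N - k) M'"
        using body[OF i(1)] i(2) unfolding hoare_def by metis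
      moreover obtain t' M'' where 2: "exec F (While b c) M' t' M''" "t' \<le> k * (l + 1) + 1" "I N M''"
        using Suc 1 unfolding hoare_def by (meson Suc_leD)
      moreover have "cval M b" using cond[of ?i M] I i by simp
      ultimately show "\<exists>t M'. exec F (While b c) M t M' \<and> t \<le> Suc k * (l + 1) + 1 \<and> I N M'"
        using exec.While_True[of M b F c t M' t' M'']
        by (intro exI[of _ "1 + t + t'"] exI[of _ M'']) auto
    qed
  qed
  from this[of N] show ?thesis by simp
qed

section \<open>The greedy program\<close>

text \<open>
  Scalar variables live at index 0 of their own array: 5 counts rounds, 6 and 8 are loop counters,
  7 is the best hyperedge found so far (\<open>length es\<close> if there is none), and 9 is positive iff that
  hyperedge has a matched member. Array 3 flags the processed hyperedges, array 4 the matched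
  nodes, and real array 2 holds the rewards under full contribution.
\<close>

abbreviation var :: "nat \<Rightarrow> nexp" where "var a \<equiv> NArr a (NConst 0)"

abbreviation set_var :: "nat \<Rightarrow> nexp \<Rightarrow> prog" where "set_var a x \<equiv> NAssign a (NConst 0) x"

abbreviation inc_var :: "nat \<Rightarrow> prog" where "inc_var a \<equiv> set_var a (NAdd (var a) (NConst 1))"

abbreviation edge_count :: nexp where "edge_count \<equiv> NArr 0 (NConst 1)"

abbreviation in_block :: cond where
  "in_block \<equiv> NLess (var 8) (NArr 1 (NAdd (var 7) (NConst 1)))"

text \<open>Real array 0 holds the budgets, so it serves directly as the query argument for full
  contribution.\<close>

definition rewards_prog :: prog where
  "rewards_prog =
     Seq (set_var 6 (NConst 0))
       (While (NLess (var 6) edge_count) (Seq (Query 2 (var 6) (var 6) 0) (inc_var 6)))"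

text \<open>The nested negations encode a disjunction: an unprocessed hyperedge is taken if there is
  no candidate yet or if it is strictly better.\<close>

definition find_prog :: prog where
  "find_prog =
     Seq (set_var 7 edge_count) (Seq (set_var 6 (NConst 0))
       (While (NLess (var 6) edge_count) (Seq
         (IfElse (CAnd (CNot (NLess (NConst 0) (NArr 3 (var 6))))
             (CNot (CAnd (NLess (var 7) edge_count)
               (CNot (RLess (RArr 2 (var 7)) (RArr 2 (var 6)))))))
           (set_var 7 (var 6)) Skip)
         (inc_var 6))))"

definition check_prog :: prog where
  "check_prog =
     Seq (set_var 9 (NConst 0)) (Seq (set_var 8 (NArr 1 (var 7)))
       (While in_block (Seq (set_var 9 (NAdd (var 9) (NArr 4 (NArr 2 (var 8))))) (inc_var 8))))"

text \<open>The cursor into the member list doubles as the output position, because real array 1 is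
  aligned with that list.\<close>

definition select_prog :: prog where
  "select_prog =
     Seq (set_var 8 (NArr 1 (var 7)))
       (While in_block (Seq (NAssign 4 (NArr 2 (var 8)) (NConst 1))
         (Seq (RAssign 1 (var 8) (RArr 0 (NArr 2 (var 8)))) (inc_var 8))))"

definition round_prog :: prog where
  "round_prog =
     Seq find_prog (Seq (NAssign 3 (var 7) (NConst 1)) (Seq check_prog
       (Seq (IfElse (NLess (NConst 0) (var 9)) Skip select_prog) (inc_var 5))))"

definition greedy_prog :: prog where
  "greedy_prog =
     Seq rewards_prog (Seq (set_var 5 (NConst 0)) (While (NLess (var 5) edge_count) round_prog))"

section \<open>Memory updates and the layout of the member lists\<close>

lemma nmem_nstore:
  "nmem (nstore a i k M) b l = (if a = b \<and> i = l then k else nmem M b l)"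
  "rmem (nstore a i k M) = rmem M"
  by (auto simp: nstore_def)

lemma rmem_rstore:
  "rmem (rstore a i x M) b l = (if a = b \<and> i = l then x else rmem M b l)"
  "nmem (rstore a i x M) = nmem M"
  by (auto simp: rstore_def)

lemma offset_Suc: "j < length es \<Longrightarrow> offset es (Suc j) = offset es j + length (es ! j)"
  by (simp add: offset_def take_Suc_conv_app_nth)

lemma offset_mono: "i \<le> j \<Longrightarrow> offset es i \<le> offset es j"
  unfolding offset_def
  by (metis concat_append le_add1 le_add_diff_inverse length_append take_add)

lemma offset_block_le: "j < length es \<Longrightarrow> offset es j + length (es ! j) \<le> length (concat es)"
  using offset_mono[of "Suc j" "length es" es] by (simp add: offset_Suc) (simp add: offset_def)

lemma nth_concat_offset:
  assumes "j < length es" "i < length (es ! j)"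
  shows "concat es ! (offset es j + i) = es ! j ! i"
proof -
  have "concat es = concat (take j es) @ es ! j @ concat (drop (Suc j) es)"
    by (metis assms(1) concat.simps(2) concat_append id_take_nth_drop)
  then show ?thesis using assms(2) by (simp add: offset_def nth_append)
qed

text \<open>By monotonicity of \<open>offset\<close> at \<open>Suc j\<close>, a block ends before
  later ones begin. Hence a write to one output cell affects a single hyperedge-member pair.\<close>

lemma offset_inj:
  assumes "j < length es" "i < length (es ! j)" "j' < length es" "i' < length (es ! j')"
    and "offset es j + i = offset es j' + i'"
  shows "j = j' \<and> i = i'"
proof -
  have "\<not> j < j'" using offset_mono[of "Suc j" j' es] assms by (auto simp: offset_Suc)
  moreover have "\<not> j' < j" using offset_mono[of "Suc j'" j es] assms by (auto simp: offset_Suc)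
  ultimately have "j = j'" by simp
  with assms show ?thesis by simp
qed

section \<open>Correctness and cost of the program\<close>

locale presented_game =
  fixes G :: "nat game" and n :: nat and es :: "nat list list"
  assumes game: "convex_zero_game G" and pres: "presents n es G"
begin

abbreviation edge :: "nat \<Rightarrow> nat set" where "edge j \<equiv> set (es ! j)"

abbreviation edge_reward :: "nat \<Rightarrow> real" where "edge_reward j \<equiv> full_reward G (edge j)"

abbreviation m :: nat where "m \<equiv> length es"

abbreviation oracle_fun :: "nat \<Rightarrow> (nat \<Rightarrow> real) \<Rightarrow> real" where
  "oracle_fun \<equiv> reward_oracle es G"

text \<open>The first \<open>k\<close> rewards are known, \<open>q\<close> rounds are over, \<open>D\<close> is the set of processed hyperedges,
  \<open>C\<close> the set of matched nodes, and \<open>W\<close> the set of output positions already written.\<close>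

definition rep ::
    "nat \<Rightarrow> nat \<Rightarrow> nat set \<Rightarrow> nat set \<Rightarrow> (nat \<times> nat) set \<Rightarrow> memory \<Rightarrow> bool" where
  "rep k q D C W M \<longleftrightarrow>
     nmem M 0 1 = m \<and> (\<forall>i\<le>m. nmem M 1 i = offset es i) \<and>
     (\<forall>i < length (concat es). nmem M 2 i = concat es ! i) \<and>
     (\<forall>v<n. rmem M 0 v = budget G v) \<and>
     (\<forall>j<k. rmem M 2 j = edge_reward j) \<and>
     nmem M 5 0 = q \<and>
     (\<forall>j<m. 0 < nmem M 3 j \<longleftrightarrow> j \<in> D) \<and>
     (\<forall>v<n. 0 < nmem M 4 v \<longleftrightarrow> v \<in> C) \<and>
     (\<forall>j<m. \<forall>i<length (es ! j).
        rmem M 1 (offset es j + i) = (if (j, i) \<in> W then budget G (es ! j ! i) else 0))"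

lemma edge_subset: "j < m \<Longrightarrow> edge j \<subseteq> {..<n}"
proof -
  assume "j < m"
  then have "edge j \<in> set ` set es" by simp
  then have "edge j \<in> hyperedges G" using pres by (simp add: presents_def)
  then have "edge j \<subseteq> nodes G" using game by (auto simp: convex_zero_game_def contribution_game_def)
  then show ?thesis using pres by (simp add: presents_def)
qed

lemma member_less: "j < m \<Longrightarrow> i < length (es ! j) \<Longrightarrow> es ! j ! i < n"
  using edge_subset nth_mem by blast

lemma rep_scratch:
  "5 < a \<Longrightarrow> rep k q D C W (nstore a i x M) \<longleftrightarrow> rep k q D C W M"
  by (simp add: rep_def nmem_nstore)

lemmas mem_simps = nmem_nstore rmem_rstore rep_scratch

lemma rep_member:
  assumes "rep k q D C W M" "j < m" "i < length (es ! j)"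
  shows "nmem M 2 (offset es j + i) = es ! j ! i"
  using assms offset_block_le[of j es] nth_concat_offset[of j es i] by (simp add: rep_def)

text \<open>Time bounds here and in the later triples stay unevaluated so that they match the sums
  built by \<open>hoare_seq\<close> and \<open>hoare_for\<close>.\<close>

lemma rewards_triple:
  "hoare oracle_fun (rep 0 0 {} {} {}) rewards_prog (1 + (m * ((1 + 1) + 1) + 1)) (rep m 0 {} {} {})"
proof -
  let ?I = "\<lambda>k M. rep k 0 {} {} {} M \<and> nmem M 6 0 = k"
  \<comment> \<open>The oracle restricts its argument to the members, all below \<open>n\<close>,
    where real array 0 agrees with the budgets.\<close>
  have answer: "oracle_fun k (rmem M 0) = edge_reward k" if "rep k 0 {} {} {} M" "k < m" for k M
  proof -
    have "restrict (rmem M 0) (edge k) = restrict (budget G) (edge k)"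
      using that edge_subset[of k] by (intro restrict_ext) (auto simp: rep_def)
    then show ?thesis using that by (simp add: reward_oracle_def full_reward_def)
  qed
  have "hoare oracle_fun (?I k) (Seq (Query 2 (var 6) (var 6) 0) (inc_var 6)) (1 + 1) (?I (Suc k))"
    if "k < m" for k
  proof (rule hoare_seq)
    show "hoare oracle_fun (?I k) (Query 2 (var 6) (var 6) 0) 1
        (\<lambda>M. rep (Suc k) 0 {} {} {} M \<and> nmem M 6 0 = k)"
    proof (rule hoare_query)
      fix M assume M: "?I k M"
      then show "rep (Suc k) 0 {} {} {} (rstore 2 (nval M (var 6)) (oracle_fun (nval M (var 6)) (rmem M 0)) M) \<and>
          nmem (rstore 2 (nval M (var 6)) (oracle_fun (nval M (var 6)) (rmem M 0)) M) 6 0 = k"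
        using answer[of k M] that by (auto simp: rep_def mem_simps less_Suc_eq)
    qed
    show "hoare oracle_fun (\<lambda>M. rep (Suc k) 0 {} {} {} M \<and> nmem M 6 0 = k) (inc_var 6) 1 (?I (Suc k))"
      by (rule hoare_nassign) (simp add: mem_simps)
  qed
  then have loop: "hoare oracle_fun (?I 0) (While (NLess (var 6) edge_count)
      (Seq (Query 2 (var 6) (var 6) 0) (inc_var 6))) (m * ((1 + 1) + 1) + 1) (?I m)"
    by (rule hoare_for) (auto simp: rep_def)
  have "hoare oracle_fun (rep 0 0 {} {} {}) rewards_prog (1 + (m * ((1 + 1) + 1) + 1)) (?I m)"
    unfolding rewards_prog_def
    by (rule hoare_seq[OF hoare_nassign loop]) (simp add: mem_simps)
  then show ?thesis by (rule hoare_conseq) auto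
qed

definition best :: "nat set \<Rightarrow> nat \<Rightarrow> nat \<Rightarrow> bool" where
  "best D k b \<longleftrightarrow> (if {..<k} \<subseteq> D then b = m
     else b \<in> {..<k} - D \<and> (\<forall>j\<in>{..<k} - D. edge_reward j \<le> edge_reward b))"

lemma find_triple:
  "hoare oracle_fun (rep m q D C W) find_prog (1 + (1 + (m * (((1 + 1) + 1) + 1) + 1)))
     (\<lambda>M. rep m q D C W M \<and> best D m (nmem M 7 0))"
proof -
  let ?I = "\<lambda>k M. rep m q D C W M \<and> nmem M 6 0 = k \<and> best D k (nmem M 7 0)"
  let ?J = "\<lambda>k M. rep m q D C W M \<and> nmem M 6 0 = k \<and> best D (Suc k) (nmem M 7 0)"
  let ?c = "CAnd (CNot (NLess (NConst 0) (NArr 3 (var 6))))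
             (CNot (CAnd (NLess (var 7) edge_count)
               (CNot (RLess (RArr 2 (var 7)) (RArr 2 (var 6))))))"
  let ?new = "\<lambda>k b. k \<notin> D \<and> \<not> (b < m \<and> \<not> edge_reward b < edge_reward k)"
  \<comment> \<open>Without a candidate \<open>b = m\<close>, which switches the comparison off, so
    any unprocessed \<open>k\<close> is accepted; otherwise a strict improvement makes
    \<open>k\<close> the new maximizer.\<close>
  have best_step:
    "(?new k b \<longrightarrow> best D (Suc k) k) \<and> (\<not> ?new k b \<longrightarrow> best D (Suc k) b)"
    if k: "k < m" and b: "best D k b" for k b
  proof (cases "{..<k} \<subseteq> D")
    case True
    then have "b = m" using b by (simp add: best_def)
    then show ?thesis
      using True by (auto simp: best_def lessThan_Suc)
  next
    case False
    then have b': "b < k" "b \<notin> D" and mx: "\<And>j. j < k \<Longrightarrow> j \<notin> D \<Longrightarrow> edge_reward j \<le> edge_reward b"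
      using b by (auto simp: best_def)
    have "edge_reward j \<le> edge_reward k" if "edge_reward b < edge_reward k" "j < k" "j \<notin> D" for j
      using mx[OF that(2,3)] that(1) by simp
    then show ?thesis
      using False b' mx k by (auto simp: best_def lessThan_Suc)
  qed
  \<comment> \<open>If \<open>nmem M 7 0 = m\<close>, the reward cell read there has unknown
    content, but the guard \<open>b < m\<close> already decides the test.\<close>
  have cond: "cval M ?c \<longleftrightarrow> ?new k (nmem M 7 0)"
    if "?I k M" "k < m" for k M
    using that by (auto simp: rep_def)
  have "hoare oracle_fun (?I k) (Seq (IfElse ?c (set_var 7 (var 6)) Skip) (inc_var 6))
      ((1 + 1) + 1) (?I (Suc k))" if k: "k < m" for k
  proof (rule hoare_seq[OF hoare_if])
    show "hoare oracle_fun (\<lambda>M. ?I k M \<and> cval M ?c) (set_var 7 (var 6)) 1 (?J k)"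
    proof (rule hoare_nassign)
      fix M assume M: "?I k M \<and> cval M ?c"
      then have "best D (Suc k) k"
        using best_step[OF k, of "nmem M 7 0"] cond[of M k] k by blast
      with M show "?J k (nstore 7 (nval M (NConst 0)) (nval M (var 6)) M)"
        by (simp add: mem_simps)
    qed
    show "hoare oracle_fun (\<lambda>M. ?I k M \<and> \<not> cval M ?c) Skip 1 (?J k)"
    proof (rule hoare_skip)
      fix M assume M: "?I k M \<and> \<not> cval M ?c"
      then have "best D (Suc k) (nmem M 7 0)"
        using best_step[OF k, of "nmem M 7 0"] cond[of M k] k by blast
      with M show "?J k M" by blast
    qed
    show "hoare oracle_fun (?J k) (inc_var 6) 1 (?I (Suc k))"
      by (rule hoare_nassign) (simp add: mem_simps)
  qed
  then have loop: "hoare oracle_fun (?I 0) (While (NLess (var 6) edge_count)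
      (Seq (IfElse ?c (set_var 7 (var 6)) Skip) (inc_var 6))) (m * (((1 + 1) + 1) + 1) + 1) (?I m)"
    by (rule hoare_for) (auto simp: rep_def)
  have "hoare oracle_fun (rep m q D C W) find_prog (1 + (1 + (m * (((1 + 1) + 1) + 1) + 1))) (?I m)"
    unfolding find_prog_def
  proof (rule hoare_seq[OF hoare_nassign hoare_seq[OF hoare_nassign loop]])
    show "rep m q D C W (nstore 7 (nval M (NConst 0)) (nval M edge_count) M) \<and>
        nmem (nstore 7 (nval M (NConst 0)) (nval M edge_count) M) 7 0 = m"
      if "rep m q D C W M" for M using that by (simp add: mem_simps) (simp add: rep_def)
    show "?I 0 (nstore 6 (nval M (NConst 0)) (nval M (NConst 0)) M)"
      if "rep m q D C W M \<and> nmem M 7 0 = m" for M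
      using that by (simp add: mem_simps best_def)
  qed
  then show ?thesis by (rule hoare_conseq) auto
qed

text \<open>Block \<open>b\<close> ends at the offset of \<open>b + 1\<close>; for the last
  hyperedge this is the entry with index \<open>m\<close>, which \<open>rep\<close>
  includes.\<close>

lemma in_block_iff:
  assumes "rep k q D C W M" "b < m" "nmem M 7 0 = b" "nmem M 8 0 = offset es b + i"
  shows "cval M in_block \<longleftrightarrow> i < length (es ! b)"
  using assms by (simp add: rep_def offset_Suc)

lemma check_triple:
  assumes b: "b < m"
  shows "hoare oracle_fun (\<lambda>M. rep m q D C W M \<and> nmem M 7 0 = b) check_prog
     (1 + (1 + (length (es ! b) * ((1 + 1) + 1) + 1)))
     (\<lambda>M. rep m q D C W M \<and> nmem M 7 0 = b \<and> (0 < nmem M 9 0 \<longleftrightarrow> edge b \<inter> C \<noteq> {}))"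
proof -
  let ?l = "length (es ! b)"
  let ?I = "\<lambda>k M. rep m q D C W M \<and> nmem M 7 0 = b \<and> nmem M 8 0 = offset es b + k \<and>
      (0 < nmem M 9 0 \<longleftrightarrow> set (take k (es ! b)) \<inter> C \<noteq> {})"
  \<comment> \<open>Intermediate assertion: member \<open>k\<close> is accounted for, but the cursor
    has not moved.\<close>
  let ?J = "\<lambda>k M. rep m q D C W M \<and> nmem M 7 0 = b \<and> nmem M 8 0 = offset es b + k \<and>
      (0 < nmem M 9 0 \<longleftrightarrow> set (take (Suc k) (es ! b)) \<inter> C \<noteq> {})"
  have "hoare oracle_fun (?I k) (Seq (set_var 9 (NAdd (var 9) (NArr 4 (NArr 2 (var 8))))) (inc_var 8))
      (1 + 1) (?I (Suc k))" if k: "k < ?l" for k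
  proof (rule hoare_seq)
    show "hoare oracle_fun (?I k) (set_var 9 (NAdd (var 9) (NArr 4 (NArr 2 (var 8))))) 1 (?J k)"
    proof (rule hoare_nassign)
      fix M assume M: "?I k M"
      then have "nmem M 2 (nmem M 8 0) = es ! b ! k" using rep_member[of m q D C W M b k] b k by simp
      moreover have "0 < nmem M 4 (es ! b ! k) \<longleftrightarrow> es ! b ! k \<in> C"
        using M member_less[OF b k] by (simp add: rep_def)
      ultimately show "?J k (nstore 9 (nval M (NConst 0))
          (nval M (NAdd (var 9) (NArr 4 (NArr 2 (var 8))))) M)"
        using M k by (auto simp: mem_simps take_Suc_conv_app_nth)
    qed
    show "hoare oracle_fun (?J k) (inc_var 8) 1 (?I (Suc k))"
      by (rule hoare_nassign) (simp add: mem_simps)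
  qed
  moreover have "cval M in_block \<longleftrightarrow> k < ?l" if "?I k M" for k M
    using in_block_iff[OF _ b, of m q D C W M k] that by blast
  ultimately have loop: "hoare oracle_fun (?I 0) (While in_block
      (Seq (set_var 9 (NAdd (var 9) (NArr 4 (NArr 2 (var 8))))) (inc_var 8)))
      (?l * ((1 + 1) + 1) + 1) (?I ?l)"
    by (rule hoare_for)
  have "hoare oracle_fun (\<lambda>M. rep m q D C W M \<and> nmem M 7 0 = b) check_prog
     (1 + (1 + (?l * ((1 + 1) + 1) + 1))) (?I ?l)"
    unfolding check_prog_def
  proof (rule hoare_seq[OF hoare_nassign hoare_seq[OF hoare_nassign loop]])
    show "rep m q D C W (nstore 9 (nval M (NConst 0)) (nval M (NConst 0)) M) \<and>
        nmem (nstore 9 (nval M (NConst 0)) (nval M (NConst 0)) M) 7 0 = b \<and>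
        nmem (nstore 9 (nval M (NConst 0)) (nval M (NConst 0)) M) 9 0 = 0"
      if "rep m q D C W M \<and> nmem M 7 0 = b" for M using that by (simp add: mem_simps)
    show "?I 0 (nstore 8 (nval M (NConst 0)) (nval M (NArr 1 (var 7))) M)"
      if "rep m q D C W M \<and> nmem M 7 0 = b \<and> nmem M 9 0 = 0" for M
      using that b by (simp add: mem_simps) (simp add: rep_def)
  qed
  then show ?thesis by (rule hoare_conseq) auto
qed

lemma select_triple:
  assumes b: "b < m"
  shows "hoare oracle_fun (\<lambda>M. rep m q D C W M \<and> nmem M 7 0 = b) select_prog
     (1 + (length (es ! b) * ((1 + (1 + 1)) + 1) + 1))
     (rep m q D (C \<union> edge b) (W \<union> {b} \<times> {..<length (es ! b)}))"
proof -
  let ?l = "length (es ! b)"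
  \<comment> \<open>Two indices, because the node flags advance one assignment before the output
    cells.\<close>
  let ?rep = "\<lambda>i k. rep m q D (C \<union> set (take i (es ! b))) (W \<union> {b} \<times> {..<k})"
  let ?P = "\<lambda>k M. nmem M 7 0 = b \<and> nmem M 8 0 = offset es b + k"
  have "hoare oracle_fun (\<lambda>M. ?rep k k M \<and> ?P k M) (Seq (NAssign 4 (NArr 2 (var 8)) (NConst 1))
         (Seq (RAssign 1 (var 8) (RArr 0 (NArr 2 (var 8)))) (inc_var 8)))
      (1 + (1 + 1)) (\<lambda>M. ?rep (Suc k) (Suc k) M \<and> ?P (Suc k) M)" if k: "k < ?l" for k
  proof (rule hoare_seq[OF _ hoare_seq])
    show "hoare oracle_fun (\<lambda>M. ?rep k k M \<and> ?P k M) (NAssign 4 (NArr 2 (var 8)) (NConst 1)) 1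
        (\<lambda>M. ?rep (Suc k) k M \<and> ?P k M)"
    proof (rule hoare_nassign)
      fix M assume M: "?rep k k M \<and> ?P k M"
      then have "nmem M 2 (nmem M 8 0) = es ! b ! k" using rep_member[OF _ b k] by auto
      then show "?rep (Suc k) k (nstore 4 (nval M (NArr 2 (var 8))) (nval M (NConst 1)) M) \<and>
          ?P k (nstore 4 (nval M (NArr 2 (var 8))) (nval M (NConst 1)) M)"
        using M k by (auto simp: rep_def mem_simps take_Suc_conv_app_nth)
    qed
    show "hoare oracle_fun (\<lambda>M. ?rep (Suc k) k M \<and> ?P k M)
        (RAssign 1 (var 8) (RArr 0 (NArr 2 (var 8)))) 1 (\<lambda>M. ?rep (Suc k) (Suc k) M \<and> ?P k M)"
    proof (rule hoare_rassign)
      fix M assume M: "?rep (Suc k) k M \<and> ?P k M"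
      then have mem: "nmem M 2 (offset es b + k) = es ! b ! k" using rep_member[OF _ b k] by auto
      have bud: "rmem M 0 (es ! b ! k) = budget G (es ! b ! k)"
        using M member_less[OF b k] by (simp add: rep_def)
      have pos: "offset es b + k = offset es j + i \<longleftrightarrow> j = b \<and> i = k"
        if "j < m" "i < length (es ! j)" for i j
        using offset_inj[OF b k that] by auto
      show "?rep (Suc k) (Suc k) (rstore 1 (nval M (var 8)) (rval M (RArr 0 (NArr 2 (var 8)))) M) \<and>
          ?P k (rstore 1 (nval M (var 8)) (rval M (RArr 0 (NArr 2 (var 8)))) M)"
        using M k by (simp add: rep_def mem_simps mem bud pos less_Suc_eq) auto
    qed
    show "hoare oracle_fun (\<lambda>M. ?rep (Suc k) (Suc k) M \<and> ?P k M) (inc_var 8) 1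
        (\<lambda>M. ?rep (Suc k) (Suc k) M \<and> ?P (Suc k) M)"
      by (rule hoare_nassign) (simp add: mem_simps)
  qed
  moreover have "cval M in_block \<longleftrightarrow> k < ?l" if "?rep k k M \<and> ?P k M" for k M
    using in_block_iff[OF _ b] that by blast
  ultimately have loop: "hoare oracle_fun (\<lambda>M. ?rep 0 0 M \<and> ?P 0 M)
      (While in_block (Seq (NAssign 4 (NArr 2 (var 8)) (NConst 1))
         (Seq (RAssign 1 (var 8) (RArr 0 (NArr 2 (var 8)))) (inc_var 8))))
      (?l * ((1 + (1 + 1)) + 1) + 1) (\<lambda>M. ?rep ?l ?l M \<and> ?P ?l M)"
    by (rule hoare_for[where I = "\<lambda>k M. ?rep k k M \<and> ?P k M"])
  have "hoare oracle_fun (\<lambda>M. rep m q D C W M \<and> nmem M 7 0 = b) select_prog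
      (1 + (?l * ((1 + (1 + 1)) + 1) + 1)) (\<lambda>M. ?rep ?l ?l M \<and> ?P ?l M)"
    unfolding select_prog_def
  proof (rule hoare_seq[OF hoare_nassign loop])
    show "?rep 0 0 (nstore 8 (nval M (NConst 0)) (nval M (NArr 1 (var 7))) M) \<and>
        ?P 0 (nstore 8 (nval M (NConst 0)) (nval M (NArr 1 (var 7))) M)"
      if "rep m q D C W M \<and> nmem M 7 0 = b" for M
      using that b by (simp add: mem_simps) (simp add: rep_def)
  qed
  then show ?thesis by (rule hoare_conseq) auto
qed

text \<open>Ties the memory to the abstract greedy run. \<open>S \<times> UNIV\<close> marks whole
  blocks as written, since \<open>rep\<close> looks only at positions inside blocks.\<close>

definition stage :: "nat \<Rightarrow> memory \<Rightarrow> bool" where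
  "stage q M \<longleftrightarrow> (\<exists>D S. greedy_stage edge edge_reward {..<m} D S \<and> card D = q \<and>
     rep m q D (\<Union>(edge ` S)) (S \<times> UNIV) M)"

text \<open>The search costs 4 per hyperedge, checking 3 and selecting 4 per member, one block being
  bounded by the whole list; 12 covers the constant overhead.\<close>

definition round_time :: nat where
  "round_time = 4 * m + 7 * length (concat es) + 12"

lemma round_triple:
  assumes q: "q < m"
  shows "hoare oracle_fun (stage q) round_prog round_time (stage (Suc q))"
proof -
  have main: "hoare oracle_fun (rep m q D (\<Union>(edge ` S)) (S \<times> UNIV)) round_prog round_time (stage (Suc q))"
    if g: "greedy_stage edge edge_reward {..<m} D S" and D: "card D = q" for D S
  proof -
    let ?C = "\<Union>(edge ` S)"
    let ?W = "S \<times> (UNIV :: nat set)"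
    let ?rest = "Seq (NAssign 3 (var 7) (NConst 1)) (Seq check_prog
       (Seq (IfElse (NLess (NConst 0) (var 9)) Skip select_prog) (inc_var 5)))"
    have DS: "S \<subseteq> D" "D \<subseteq> {..<m}" using g by (auto simp: greedy_stage_def)
    \<comment> \<open>As \<open>card D = q < m\<close>, some hyperedge is unprocessed, so
      \<open>best\<close> gives a true maximizer and not the marker \<open>m\<close>.\<close>
    have "\<not> {..<m} \<subseteq> D"
      using card_mono[of D "{..<m}"] DS D q finite_subset[OF DS(2)] by auto
    then have best: "b \<in> {..<m} - D" "\<And>j. j \<in> {..<m} - D \<Longrightarrow> edge_reward j \<le> edge_reward b"
      if "best D m b" for b using that by (auto simp: best_def)
    \<comment> \<open>Fixing the value \<open>b\<close> of scalar 7 makes the triples for a given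
      block applicable; \<open>hoare_ex\<close> removes it afterwards. If \<open>b\<close> is not
      best, the precondition is unsatisfiable.\<close>
    have rest: "hoare oracle_fun (\<lambda>M. rep m q D ?C ?W M \<and> best D m (nmem M 7 0) \<and> nmem M 7 0 = b)
        ?rest (7 * length (concat es) + 9) (stage (Suc q))" for b
    proof (cases "best D m b")
      case False
      then show ?thesis by (auto simp: hoare_def)
    next
      case True
      let ?l = "length (es ! b)"
      have b: "b < m" "b \<notin> D" using best(1)[OF True] by auto
      have l: "?l \<le> length (concat es)" using offset_block_le[OF b(1)] by simp
      let ?D = "insert b D"
      have card: "card ?D = Suc q" using b D finite_subset[OF DS(2)] by simp
      have W: "rep m q ?D (?C \<union> edge b) (?W \<union> {b} \<times> {..<?l}) M \<longleftrightarrow>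
          rep m q ?D (\<Union>(edge ` insert b S)) (insert b S \<times> UNIV) M" for M
        by (auto simp: rep_def Un_commute)
      \<comment> \<open>A common postcondition of both branches that hides whether \<open>b\<close>
        was selected.\<close>
      let ?post = "\<lambda>M. \<exists>S'. greedy_stage edge edge_reward {..<m} ?D S' \<and>
          rep m q ?D (\<Union>(edge ` S')) (S' \<times> UNIV) M"
      have "hoare oracle_fun (\<lambda>M. rep m q D ?C ?W M \<and> best D m (nmem M 7 0) \<and> nmem M 7 0 = b)
          ?rest (1 + ((1 + (1 + (?l * ((1 + 1) + 1) + 1))) +
            ((1 + (1 + (?l * ((1 + (1 + 1)) + 1) + 1))) + 1))) (stage (Suc q))"
      proof (rule hoare_seq[OF _ hoare_seq[OF check_triple[OF b(1)] hoare_seq[OF hoare_if]]])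
        show "hoare oracle_fun (\<lambda>M. rep m q D ?C ?W M \<and> best D m (nmem M 7 0) \<and> nmem M 7 0 = b)
            (NAssign 3 (var 7) (NConst 1)) 1 (\<lambda>M. rep m q ?D ?C ?W M \<and> nmem M 7 0 = b)"
          by (rule hoare_nassign) (auto simp: rep_def mem_simps)
        show "hoare oracle_fun (\<lambda>M. (rep m q ?D ?C ?W M \<and> nmem M 7 0 = b \<and>
            (0 < nmem M 9 0) = (edge b \<inter> ?C \<noteq> {})) \<and> cval M (NLess (NConst 0) (var 9)))
            Skip (1 + (?l * ((1 + (1 + 1)) + 1) + 1)) ?post"
        proof (rule hoare_conseq[OF hoare_skip])
          fix M
          assume "(rep m q ?D ?C ?W M \<and> nmem M 7 0 = b \<and>
            (0 < nmem M 9 0) = (edge b \<inter> ?C \<noteq> {})) \<and> cval M (NLess (NConst 0) (var 9))"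
          then have "rep m q ?D ?C ?W M" "edge b \<inter> ?C \<noteq> {}" by auto
          then show "?post M"
            using greedy_stage_skip[OF g best[OF True]] by (intro exI[of _ S]) simp
        qed auto
        show "hoare oracle_fun (\<lambda>M. (rep m q ?D ?C ?W M \<and> nmem M 7 0 = b \<and>
            (0 < nmem M 9 0) = (edge b \<inter> ?C \<noteq> {})) \<and> \<not> cval M (NLess (NConst 0) (var 9)))
            select_prog (1 + (?l * ((1 + (1 + 1)) + 1) + 1)) ?post"
        \<comment> \<open>If the sets meet, the failed test contradicts the assertion on scalar 9
          and the branch is unreachable.\<close>
        proof (cases "edge b \<inter> ?C = {}")
          case disj: True
          show ?thesis
          proof (rule hoare_conseq[OF select_triple[OF b(1)]])
            show "?post M" if "rep m q ?D (?C \<union> edge b) (?W \<union> {b} \<times> {..<?l}) M" for M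
              using greedy_stage_select[OF g best[OF True] disj] that W
              by (intro exI[of _ "insert b S"]) simp
          qed auto
        next
          case False
          then show ?thesis by (auto simp: hoare_def)
        qed
        show "hoare oracle_fun ?post (inc_var 5) 1 (stage (Suc q))"
        proof (rule hoare_nassign)
          fix M assume "?post M"
          then obtain S' where S': "greedy_stage edge edge_reward {..<m} ?D S'"
            "rep m q ?D (\<Union>(edge ` S')) (S' \<times> UNIV) M" by (elim exE conjE)
          have "rep m (Suc q) ?D (\<Union>(edge ` S')) (S' \<times> UNIV)
              (nstore 5 (nval M (NConst 0)) (nval M (NAdd (var 5) (NConst 1))) M)"
            using S'(2) by (simp add: rep_def nmem_nstore)
          with S'(1) card show "stage (Suc q) (nstore 5 (nval M (NConst 0)) (nval M (NAdd (var 5) (NConst 1))) M)"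
            unfolding stage_def by (intro exI[of _ ?D] exI[of _ S']) simp
        qed
      qed
      then show ?thesis by (rule hoare_conseq) (use l in auto)
    qed
    have "hoare oracle_fun (\<lambda>M. rep m q D ?C ?W M \<and> best D m (nmem M 7 0))
        ?rest (7 * length (concat es) + 9) (stage (Suc q))"
      using hoare_ex[where P = "\<lambda>b M. rep m q D ?C ?W M \<and> best D m (nmem M 7 0) \<and> nmem M 7 0 = b",
          OF rest]
      by (rule hoare_conseq) auto
    from hoare_seq[OF find_triple this] show ?thesis
      unfolding round_prog_def by (rule hoare_conseq) (auto simp: round_time_def)
  qed
  show ?thesis
    unfolding stage_def[of q, abs_def]
  proof (rule hoare_ex, rule hoare_ex)
    show "hoare oracle_fun (\<lambda>M. greedy_stage edge edge_reward {..<m} D S \<and> card D = q \<and>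
        rep m q D (\<Union>(edge ` S)) (S \<times> UNIV) M) round_prog round_time (stage (Suc q))" for D S
      using main[of D S] unfolding hoare_def by blast
  qed
qed

lemma greedy_triple:
  "hoare oracle_fun (rep 0 0 {} {} {}) greedy_prog
     ((1 + (m * ((1 + 1) + 1) + 1)) + (1 + (m * (round_time + 1) + 1))) (stage m)"
  unfolding greedy_prog_def
proof (rule hoare_seq[OF rewards_triple hoare_seq[OF hoare_nassign hoare_for]])
  show "stage 0 (nstore 5 (nval M (NConst 0)) (nval M (NConst 0)) M)" if "rep m 0 {} {} {} M" for M
    unfolding stage_def using that greedy_stage_empty[of edge edge_reward "{..<m}"]
    by (intro exI[of _ "{}"]) (simp add: rep_def nmem_nstore)
  show "hoare oracle_fun (stage k) round_prog round_time (stage (Suc k))" if "k < m" for k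
    using that by (rule round_triple)
  show "cval M (NLess (var 5) edge_count) \<longleftrightarrow> k < m" if "stage k M" for k M
    using that by (auto simp: stage_def rep_def)
qed

lemma stage_equilibrium:
  assumes "stage m M"
  shows "\<exists>s. setwise_equilibrium G s \<and> stores_state es M s"
proof -
  obtain D S where g: "greedy_stage edge edge_reward {..<m} D S" and "card D = m"
    and rep: "rep m m D (\<Union>(edge ` S)) (S \<times> UNIV) M"
    using assms by (auto simp: stage_def)
  moreover have "D = {..<m}"
    using g \<open>card D = m\<close> by (intro card_subset_eq) (auto simp: greedy_stage_def)
  ultimately have g: "greedy_stage edge edge_reward {..<m} {..<m} S" by simp
  have "set es = (!) es ` {..<m}" by (auto simp: in_set_conv_nth)
  then have "edge ` {..<m} = set ` set es" by (simp add: image_image)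
  then have "edge ` {..<m} = hyperedges G" using pres by (simp add: presents_def)
  then have eq: "setwise_equilibrium G (matching_profile G (edge ` S))"
    using greedy_equilibrium[OF game _ g] by simp
  have "S \<subseteq> {..<m}" using g by (simp add: greedy_stage_def)
  \<comment> \<open>The output is recorded by index, the profile by set; since no hyperedge is
    listed twice, the two notions of being selected agree.\<close>
  moreover have "inj_on edge {..<m}"
    using pres by (auto simp: presents_def distinct_map inj_on_def nth_eq_iff_index_eq distinct_conv_nth)
  ultimately have mem: "edge j \<in> edge ` S \<longleftrightarrow> j \<in> S" if "j < m" for j
    using that by (auto dest: inj_onD)
  have "stores_state es M (matching_profile G (edge ` S))"
    unfolding stores_state_def matching_profile_def using rep mem by (simp add: rep_def)
  with eq show ?thesis by blast
qed

lemma initial_rep: "rep 0 0 {} {} {} (initial_memory n es G)"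
proof -
  have "rmem (initial_memory n es G) 1 i = 0" for i by (simp add: initial_memory_def)
  then show ?thesis by (simp add: rep_def initial_memory_def)
qed

lemma greedy_run:
  "\<exists>t M. exec oracle_fun greedy_prog (initial_memory n es G) t M \<and>
     t \<le> poly [:4, 16, 11:] (input_size n es) \<and> (\<exists>s. setwise_equilibrium G s \<and> stores_state es M s)"
proof -
  obtain t M where t: "exec oracle_fun greedy_prog (initial_memory n es G) t M"
    "t \<le> (1 + (m * ((1 + 1) + 1) + 1)) + (1 + (m * (round_time + 1) + 1))" "stage m M"
    using greedy_triple initial_rep unfolding hoare_def by blast
  let ?N = "input_size n es"
  \<comment> \<open>The 11 is 4 + 7, since \<open>m\<close> and \<open>length (concat es)\<close>
    are both at most \<open>?N\<close>. Expanding \<open>4 + 3 * ?N + ?N * (11 * ?N + 13)\<close>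
    gives the coefficients 4, 16, 11.\<close>
  have N: "m \<le> ?N" "round_time + 1 \<le> 11 * ?N + 13"
    by (auto simp: input_size_def round_time_def)
  have prod: "m * (round_time + 1) \<le> ?N * (11 * ?N + 13)" by (rule mult_mono) (use N in auto)
  have "t \<le> 4 + 3 * m + m * (round_time + 1)" using t(2) by simp
  also have "\<dots> \<le> 4 + 3 * ?N + ?N * (11 * ?N + 13)"
    by (intro add_mono prod) (use N in auto)
  also have "\<dots> = poly [:4, 16, 11:] ?N" by (simp add: algebra_simps)
  finally show ?thesis using t stage_equilibrium by blast
qed

end

theorem corollary8p1:
  shows "(\<forall>G :: 'v game. convex_zero_game G \<longrightarrow> (\<exists>s. setwise_equilibrium G s)) \<and>
         polytime_computable convex_zero_game setwise_equilibrium"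
proof (intro conjI allI impI)
  fix G :: "'v game"
  assume G: "convex_zero_game G"
  then have "finite (hyperedges G)"
    using finite_subset[of "hyperedges G" "Pow (nodes G)"]
    by (auto simp: convex_zero_game_def contribution_game_def)
  \<comment> \<open>Each hyperedge is its own index, so the abstract run needs no enumeration of the
    nodes.\<close>
  then obtain S where "greedy_stage (\<lambda>e. e) (full_reward G) (hyperedges G) (hyperedges G) S"
    using greedy_stage_exists by blast
  then have "setwise_equilibrium G (matching_profile G ((\<lambda>e. e) ` S))"
    by (intro greedy_equilibrium[OF G]) auto
  then show "\<exists>s. setwise_equilibrium G s" by blast
next
  show "polytime_computable convex_zero_game setwise_equilibrium"
    unfolding polytime_computable_def
  proof (intro exI[of _ greedy_prog] exI[of _ "[:4, 16, 11:]"] allI impI)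
    fix G n es
    assume "convex_zero_game G" "presents n es G"
    then interpret presented_game G n es by unfold_locales
    show "\<exists>t M. exec oracle_fun greedy_prog (initial_memory n es G) t M \<and>
        t \<le> poly [:4, 16, 11:] (input_size n es) \<and>
        (\<exists>s. setwise_equilibrium G s \<and> stores_state es M s)"
      by (rule greedy_run)
  qed
qed

end
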